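(* Let $\mathcal H$ be a real or complex separable Hilbert space. Let $B$ be a positive operator on $\mathcal H$ with finite rank $n$ and nonzero eigenvalues (counted with multiplicity) $b_1 \geq b_2 \geq \cdots \geq b_n > 0$. Let $k \geq n$ be an integer and let $\{c_i\}_{i=1}^k$ be a nonincreasing sequence of positive numbers such that $\sum_{i=1}^k c_i = \sum_{j=1}^n b_j$. Then there exist unit vectors $\{x_i\}_{i=1}^k$ in $\mathcal H$ such that $$B = \sum_{i=1}^k c_i (x_i \otimes x_i)$$ if and only if for each $p$ with $1 \leq p \leq n-1$, $$\sum_{i=1}^p c_i \leq \sum_{i=1}^p b_i .$$
   Context: "Positive operator" means a bounded self-adjoint operator $B$ with $\langle Bx, x\rangle \geq 0$ for all $x \in \mathcal H$. For $u, v \in \mathcal H$, the operator $u \otimes v$ on $\mathcal H$ is defined by $(u \otimes v)x = \langle x, v\rangle u$; in particular, for a unit vector $u$, $u \otimes u$ is the orthogonal projection onto the span of $u$. *)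

theory Defs
  imports "HOL-Analysis.Analysis"
begin

text \<open>
  The scalar fields: exactly \<open>\<real>\<close> with trivial conjugation and \<open>\<complex>\<close> with complex
  conjugation (up to isomorphism), so that a type variable of this class ranges over the
  two cases ``real or complex''. The map \<open>a \<mapsto> a *\<^sub>R 1\<close> is the embedding \<open>of_real\<close>.
\<close>

class real_or_complex = real_field +
  fixes sconj :: "'a \<Rightarrow> 'a"
  assumes real_or_complex:
    "(\<forall>z. (\<exists>a. z = a *\<^sub>R 1) \<and> sconj z = z) \<or>
     (\<exists>i. i * i = - 1 \<and> (\<forall>z. \<exists>a b. z = a *\<^sub>R 1 + b *\<^sub>R i \<and> sconj z = a *\<^sub>R 1 - b *\<^sub>R i))"

instantiation real :: real_or_complex
begin
definition sconj_real :: "real \<Rightarrow> real" where "sconj_real z = z"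
instance by standard (simp add: sconj_real_def)
end

instantiation complex :: real_or_complex
begin
definition sconj_complex :: "complex \<Rightarrow> complex" where "sconj_complex z = cnj z"
instance
proof
  have "\<forall>z. \<exists>a b. z = a *\<^sub>R 1 + b *\<^sub>R \<i> \<and> sconj z = a *\<^sub>R 1 - b *\<^sub>R \<i>"
  proof
    fix z :: complex
    have "z = Re z *\<^sub>R 1 + Im z *\<^sub>R \<i> \<and> sconj z = Re z *\<^sub>R 1 - Im z *\<^sub>R \<i>"
      by (simp add: sconj_complex_def complex_eq_iff)
    then show "\<exists>a b. z = a *\<^sub>R 1 + b *\<^sub>R \<i> \<and> sconj z = a *\<^sub>R 1 - b *\<^sub>R \<i>" by blast
  qed
  moreover have "\<i> * \<i> = - 1" by simp
  ultimately show "(\<forall>z::complex. (\<exists>a. z = a *\<^sub>R 1) \<and> sconj z = z) \<or>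
     (\<exists>i::complex. i * i = - 1 \<and>
        (\<forall>z. \<exists>a b. z = a *\<^sub>R 1 + b *\<^sub>R i \<and> sconj z = a *\<^sub>R 1 - b *\<^sub>R i))"
    by blast
qed
end

text \<open>
  A Hilbert space over \<open>'k\<close>. The norm, the topology and completeness are those of the class
  \<^class>\<open>banach\<close>; \<open>ip_self\<close> says that the norm is the one induced by the inner
  product (in particular the inner product is positive definite), and \<open>scale_of_real\<close>
  that the scalar multiplication extends the real one of the class. The inner product is
  linear in its first argument.
\<close>

locale hilbert_space = vector_space scale
  for scale :: "'k::real_or_complex \<Rightarrow> 'v::banach \<Rightarrow> 'v" +
  fixes ip :: "'v \<Rightarrow> 'v \<Rightarrow> 'k"
  assumes scale_of_real: "scale (of_real r) x = r *\<^sub>R x"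
    and ip_add_left: "ip (x + y) z = ip x z + ip y z"
    and ip_scale_left: "ip (scale a x) y = a * ip x y"
    and ip_conj: "ip y x = sconj (ip x y)"
    and ip_self: "ip x x = of_real ((norm x)\<^sup>2)"
begin

definition bounded_operator :: "('v \<Rightarrow> 'v) \<Rightarrow> bool" where
  "bounded_operator B \<longleftrightarrow>
     Vector_Spaces.linear scale scale B \<and> (\<exists>K. \<forall>x. norm (B x) \<le> K * norm x)"

definition self_adjoint :: "('v \<Rightarrow> 'v) \<Rightarrow> bool" where
  "self_adjoint B \<longleftrightarrow> (\<forall>x y. ip (B x) y = ip x (B y))"

definition positive_operator :: "('v \<Rightarrow> 'v) \<Rightarrow> bool" where
  "positive_operator B \<longleftrightarrow>
     bounded_operator B \<and> self_adjoint B \<and> (\<forall>x. \<exists>r\<ge>0. ip (B x) x = of_real r)"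

text \<open>
  The first conjunct is needed because \<open>dim\<close> is \<open>0\<close> on infinite-dimensional subspaces.
\<close>

definition has_finite_rank :: "('v \<Rightarrow> 'v) \<Rightarrow> nat \<Rightarrow> bool" where
  "has_finite_rank B n \<longleftrightarrow>
     (\<exists>S. finite S \<and> range B \<subseteq> span S) \<and> dim (range B) = n"

definition eigenspace :: "('v \<Rightarrow> 'v) \<Rightarrow> 'k \<Rightarrow> 'v set" where
  "eigenspace B l = {x. B x = scale l x}"

text \<open>
  \<open>b 1, \<dots>, b n\<close> lists the nonzero eigenvalues with multiplicity: every nonzero scalar
  occurs as often as the dimension of its eigenspace (\<open>0\<close> times if it is no eigenvalue).
  This is meant for operators of finite rank, whose eigenspaces for nonzero scalars are
  finite-dimensional.
\<close>

definition lists_nonzero_eigenvalues :: "('v \<Rightarrow> 'v) \<Rightarrow> nat \<Rightarrow> (nat \<Rightarrow> real) \<Rightarrow> bool" where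
  "lists_nonzero_eigenvalues B n b \<longleftrightarrow>
     (\<forall>j\<in>{1..n}. b j \<noteq> 0) \<and>
     (\<forall>l. l \<noteq> 0 \<longrightarrow> card {j \<in> {1..n}. of_real (b j) = l} = dim (eigenspace B l))"

definition rank_one :: "'v \<Rightarrow> 'v \<Rightarrow> 'v \<Rightarrow> 'v" where
  "rank_one u v = (\<lambda>x. scale (ip x v) u)"

end

locale separable_hilbert_space = hilbert_space scale ip
  for scale :: "'k::real_or_complex \<Rightarrow> 'v::banach \<Rightarrow> 'v" and ip :: "'v \<Rightarrow> 'v \<Rightarrow> 'k" +
  assumes separable: "separable_space (euclidean :: 'v topology)"

text \<open>The library's real Hilbert spaces, and \<open>\<complex>\<close> over itself, are instances.\<close>

lemma hilbert_space_real_inner: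
  "hilbert_space (scaleR :: real \<Rightarrow> 'v::{real_inner, banach} \<Rightarrow> 'v) inner"
  by standard
    (simp_all add: algebra_simps inner_commute sconj_real_def power2_norm_eq_inner)

lemma hilbert_space_complex:
  "hilbert_space ((*) :: complex \<Rightarrow> complex \<Rightarrow> complex) (\<lambda>x y. x * cnj y)"
  by standard
    (simp_all add: algebra_simps scaleR_conv_of_real sconj_complex_def flip: complex_norm_square)

end

theory Submission
  imports Defs
begin

text \<open>
  Let \<open>e\<^sub>1, \<dots>, e\<^sub>n\<close> be orthonormal eigenvectors of \<open>B\<close> for \<open>b\<^sub>1, \<dots>, b\<^sub>n\<close>, so that
  \<open>B = \<Sum>\<^sub>j b\<^sub>j (e\<^sub>j \<otimes> e\<^sub>j)\<close>. They exist by counting: the eigenspaces of nonzero eigenvalues are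
  mutually orthogonal and their dimensions add up to \<open>n\<close>, the dimension of the range
  (\<open>orthonormal_eigenvectors_exist\<close>, \<open>diagonalization\<close>).

  Necessity. Suppose \<open>B = \<Sum>\<^sub>i c\<^sub>i (x\<^sub>i \<otimes> x\<^sub>i)\<close> and consider the matrix with entries
  \<open>u\<^sub>i\<^sub>j = c\<^sub>i \<bar>\<langle>x\<^sub>i, e\<^sub>j\<rangle>\<bar>\<^sup>2 / b\<^sub>j\<close>. Computing \<open>\<langle>B e\<^sub>j, e\<^sub>j\<rangle>\<close> in two ways shows that its columns sum to
  \<open>1\<close>. Its rows sum to at most \<open>1\<close>: if \<open>y\<close> is the vector in the range of \<open>B\<close> with \<open>B y = x\<^sub>i\<close> and
  \<open>s = \<langle>x\<^sub>i, y\<rangle> = \<Sum>\<^sub>j \<bar>\<langle>x\<^sub>i, e\<^sub>j\<rangle>\<bar>\<^sup>2 / b\<^sub>j\<close>, then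
  \<open>s = \<langle>B y, y\<rangle> \<ge> c\<^sub>i \<bar>\<langle>y, x\<^sub>i\<rangle>\<bar>\<^sup>2 = c\<^sub>i s\<^sup>2\<close>.
  Since the unit vectors \<open>x\<^sub>i\<close> lie in the span of the \<open>e\<^sub>j\<close>, also \<open>c\<^sub>i = \<Sum>\<^sub>j b\<^sub>j u\<^sub>i\<^sub>j\<close>. Hence
  \<open>c\<^sub>1 + \<dots> + c\<^sub>p\<close> is a combination of the \<open>b\<^sub>j\<close> with weights in \<open>[0, 1]\<close> of total at most \<open>p\<close>, and
  such a combination is largest when the weights sit on the \<open>p\<close> largest \<open>b\<^sub>j\<close>
  (\<open>weighted_sum_le_top_sum\<close>, \<open>decomposition_imp_partial_sums_le\<close>).

  Sufficiency. With the weights absorbed, the task is to find vectors \<open>z\<^sub>1, \<dots>, z\<^sub>k\<close> with \<open>\<parallel>z\<^sub>i\<parallel>\<^sup>2 = c\<^sub>i\<close> and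
  \<open>B = \<Sum>\<^sub>i z\<^sub>i \<otimes> z\<^sub>i\<close>. The vectors \<open>\<surd>b\<^sub>1 e\<^sub>1, \<dots>, \<surd>b\<^sub>n e\<^sub>n, 0, \<dots>, 0\<close> satisfy the second
  condition. A plane rotation of a pair of vectors preserves this condition, and by the
  intermediate value theorem it can move any amount of squared length from the longer to the
  shorter one until they have exchanged their lengths (\<open>redistribute_norms\<close>). The inequalities
  say that the squared lengths majorize \<open>c\<close>, and Muirhead's argument then reaches
  \<open>c\<close> in finitely many such transfers, each of which makes at least one more length correct
  (\<open>attain_norms\<close>).
\<close>

section \<open>Conjugation and squared modulus of scalars\<close>

text \<open>
  In the complex case everything follows from uniqueness of the coordinates \<open>a\<close> and \<open>b\<close> in
  \<open>a + b i\<close>, which in turn follows from \<open>(a + b i) (a - b i) = a\<^sup>2 + b\<^sup>2\<close>.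
\<close>

lemma sconj_properties:
  fixes y z :: "'k::real_or_complex" and r :: real
  shows sconj_add: "sconj (y + z) = sconj y + sconj z"
    and sconj_mult: "sconj (y * z) = sconj y * sconj z"
    and sconj_of_real: "sconj (of_real r :: 'k) = of_real r"
    and sconj_sconj: "sconj (sconj z) = z"
    and modulus_square_exists: "\<exists>s\<ge>0. z * sconj z = of_real s"
proof -
  have "sconj (y + z) = sconj y + sconj z \<and> sconj (y * z) = sconj y * sconj z
      \<and> sconj (of_real r :: 'k) = of_real r \<and> sconj (sconj z) = z
      \<and> (\<exists>s\<ge>0. z * sconj z = of_real s)"
  proof (cases "\<forall>z::'k. (\<exists>a. z = a *\<^sub>R 1) \<and> sconj z = z")
    case True
    then obtain a where "z = a *\<^sub>R 1" by blast
    then have "z * sconj z = of_real (a * a)"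
      using True by (simp add: of_real_def)
    then have "\<exists>s\<ge>0. z * sconj z = of_real s"
      by (metis zero_le_square)
    then show ?thesis using True by simp
  next
    case False
    then obtain i :: 'k where ii: "i * i = - 1"
      and dec: "\<forall>z. \<exists>a b. z = a *\<^sub>R 1 + b *\<^sub>R i \<and> sconj z = a *\<^sub>R 1 - b *\<^sub>R i"
      using real_or_complex by blast
    have norm_form: "(of_real a + of_real b * i) * (of_real a - of_real b * i)
        = of_real (a * a + b * b)" for a b
    proof -
      have "(of_real a + of_real b * i) * (of_real a - of_real b * i)
          = of_real a * of_real a - (of_real b * of_real b) * (i * i)"
        by (simp add: algebra_simps)
      then show ?thesis by (simp add: ii)
    qed
    have zero: "a = 0 \<and> b = 0" if "of_real a + of_real b * i = 0" for a b
    proof -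
      have "of_real (a * a + b * b) = (0::'k)"
        using norm_form[of a b] that by simp
      then have "a * a + b * b = 0" by (simp only: of_real_eq_0_iff)
      then show ?thesis by (simp add: sum_squares_eq_zero_iff)
    qed
    have conj: "sconj (of_real a + of_real b * i) = of_real a - of_real b * i" for a b
    proof -
      obtain a' b' where ab: "of_real a + of_real b * i = of_real a' + of_real b' * i"
        and sc: "sconj (of_real a + of_real b * i) = of_real a' - of_real b' * i"
        using dec[rule_format, of "of_real a + of_real b * i"]
        by (auto simp: scaleR_conv_of_real)
      have "of_real (a - a') + of_real (b - b') * i = 0"
        using ab by (simp add: algebra_simps)
      from zero[OF this] sc show ?thesis by simp
    qed
    obtain a b where y: "y = of_real a + of_real b * i"
      using dec[rule_format, of y] by (auto simp: scaleR_conv_of_real)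
    obtain p q where z: "z = of_real p + of_real q * i"
      using dec[rule_format, of z] by (auto simp: scaleR_conv_of_real)
    have "y + z = of_real (a + p) + of_real (b + q) * i"
      by (simp add: y z algebra_simps)
    then have "sconj (y + z) = of_real (a + p) - of_real (b + q) * i"
      by (simp only: conj)
    also have "\<dots> = sconj y + sconj z"
      unfolding y z conj by (simp add: algebra_simps)
    finally have 1: "sconj (y + z) = sconj y + sconj z" .
    have "y * z = of_real a * of_real p + of_real b * of_real q * (i * i)
        + (of_real a * of_real q + of_real b * of_real p) * i"
      by (simp add: y z algebra_simps)
    then have "y * z = of_real (a * p - b * q) + of_real (a * q + b * p) * i"
      by (simp add: ii)
    then have "sconj (y * z) = of_real (a * p - b * q) - of_real (a * q + b * p) * i"
      by (simp only: conj)
    also have "\<dots> = of_real a * of_real p + of_real b * of_real q * (i * i)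
        - (of_real a * of_real q + of_real b * of_real p) * i"
      by (simp add: ii)
    also have "\<dots> = sconj y * sconj z"
      unfolding y z conj by (simp add: algebra_simps)
    finally have 2: "sconj (y * z) = sconj y * sconj z" .
    have 3: "sconj (of_real r :: 'k) = of_real r"
      using conj[of r 0] by simp
    have 4: "sconj (sconj z) = z"
      using conj[of p q] conj[of p "- q"] z by simp
    have "z * sconj z = of_real (p * p + q * q)"
      by (simp only: z conj norm_form)
    then have "\<exists>s\<ge>0. z * sconj z = of_real s"
      by (metis sum_squares_ge_zero)
    with 1 2 3 4 show ?thesis by blast
  qed
  then show "sconj (y + z) = sconj y + sconj z" "sconj (y * z) = sconj y * sconj z"
    "sconj (of_real r :: 'k) = of_real r" "sconj (sconj z) = z" "\<exists>s\<ge>0. z * sconj z = of_real s"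
    by blast+
qed

text \<open>
  The square of the usual absolute value, as the real number whose image in the scalar field is
  \<open>z * sconj z\<close>.
\<close>

definition modsq :: "'k::real_or_complex \<Rightarrow> real" where
  "modsq z = (THE s. z * sconj z = of_real s)"

lemma of_real_modsq: "of_real (modsq z) = z * sconj z"
  and modsq_nonneg: "0 \<le> modsq z"
proof -
  obtain s where s: "0 \<le> s" "z * sconj z = of_real s"
    using modulus_square_exists by blast
  have "modsq z = s"
    unfolding modsq_def by (rule the_equality) (use s in auto)
  with s show "of_real (modsq z) = z * sconj z" "0 \<le> modsq z" by auto
qed

lemma modsq_of_real: "modsq (of_real r) = r\<^sup>2"
proof -
  have "(of_real (modsq (of_real r :: 'a)) :: 'a) = of_real (r\<^sup>2)"
    by (simp add: of_real_modsq sconj_of_real power2_eq_square)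
  then show ?thesis by (simp only: of_real_eq_iff)
qed

lemma modsq_mult: "modsq (y * z) = modsq y * modsq z"
proof -
  have "(of_real (modsq (y * z)) :: 'a) = of_real (modsq y * modsq z)"
    by (simp add: of_real_modsq sconj_mult)
  then show ?thesis by (simp only: of_real_eq_iff)
qed

lemma modsq_eq_0_iff: "modsq z = 0 \<longleftrightarrow> z = 0"
proof
  assume "modsq z = 0"
  then have "z * sconj z = 0" by (metis of_real_0 of_real_modsq)
  then show "z = 0"
    by (metis mult_eq_0_iff of_real_0 sconj_of_real sconj_sconj)
next
  assume "z = 0"
  then show "modsq z = 0" using modsq_of_real[of 0] by simp
qed

context hilbert_space
begin

section \<open>Inner products and orthonormal families\<close>

lemma ip_add_right: "ip x (y + z) = ip x y + ip x z"
  by (metis ip_add_left ip_conj sconj_add)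

lemma ip_scale_right: "ip x (scale a y) = sconj a * ip x y"
  by (metis ip_scale_left ip_conj sconj_mult)

lemma ip_scaleR_left: "ip (r *\<^sub>R x) y = of_real r * ip x y"
  by (metis ip_scale_left scale_of_real)

lemma ip_scaleR_right: "ip x (r *\<^sub>R y) = of_real r * ip x y"
  by (metis ip_scale_right scale_of_real sconj_of_real)

lemma linear_scaleR:
  assumes "Vector_Spaces.linear scale scale f"
  shows "f (r *\<^sub>R x) = r *\<^sub>R f x"
proof -
  interpret Vector_Spaces.linear scale scale f by (rule assms)
  show ?thesis using scale[of "of_real r" x] by (simp only: scale_of_real)
qed

lemma norm_eq_1I:
  assumes "ip x x = 1"
  shows "norm x = 1"
proof -
  have "(of_real ((norm x)\<^sup>2) :: 'k) = of_real 1"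
    using assms by (simp only: ip_self of_real_1)
  then have "(norm x)\<^sup>2 = 1" by (simp only: of_real_eq_iff)
  then show ?thesis using norm_ge_zero[of x] by (simp add: power2_eq_1_iff)
qed

lemma ip_zero_left [simp]: "ip 0 y = 0"
  using ip_scaleR_left[of 0] by simp

lemma ip_zero_right [simp]: "ip y 0 = 0"
  using ip_scaleR_right[of _ 0] by simp

lemma ip_minus_left: "ip (- x) y = - ip x y"
  using ip_scaleR_left[of "-1"] by simp

lemma ip_minus_right: "ip y (- x) = - ip y x"
  using ip_scaleR_right[of _ "-1"] by simp

lemma ip_diff_left: "ip (x - z) y = ip x y - ip z y"
  by (metis diff_conv_add_uminus ip_add_left ip_minus_left)

lemma ip_sum_left: "ip (\<Sum>i\<in>I. f i) y = (\<Sum>i\<in>I. ip (f i) y)"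
  by (induction I rule: infinite_finite_induct) (auto simp: ip_add_left)

lemma ip_mult_swap: "ip x y * ip y x = of_real (modsq (ip x y))"
  by (metis ip_conj of_real_modsq)

lemma modsq_ip_commute: "modsq (ip x y) = modsq (ip y x)"
  by (metis ip_mult_swap mult.commute of_real_eq_iff)

lemma ip_eq_0_commute: "ip x y = 0 \<Longrightarrow> ip y x = 0"
  by (metis modsq_eq_0_iff modsq_ip_commute)

definition orthonormal_on :: "nat set \<Rightarrow> (nat \<Rightarrow> 'v) \<Rightarrow> bool" where
  "orthonormal_on J e \<longleftrightarrow> (\<forall>i\<in>J. \<forall>j\<in>J. ip (e i) (e j) = (if i = j then 1 else 0))"

lemma orthonormal_ip_sum_left:
  assumes "orthonormal_on J e" "finite J" "j \<in> J"
  shows "ip (\<Sum>i\<in>J. scale (f i) (e i)) (e j) = f j"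
proof -
  have "ip (\<Sum>i\<in>J. scale (f i) (e i)) (e j) = (\<Sum>i\<in>J. if i = j then f i else 0)"
    unfolding ip_sum_left ip_scale_left
    using assms by (intro sum.cong) (auto simp: orthonormal_on_def)
  then show ?thesis using assms by simp
qed

lemma orthonormal_inj_on: "orthonormal_on J e \<Longrightarrow> inj_on e J"
  unfolding orthonormal_on_def inj_on_def by (metis zero_neq_one)

lemma orthonormal_independent:
  assumes "orthonormal_on J e" "finite J"
  shows "independent (e ` J)"
proof (rule independent_if_scalars_zero)
  show "finite (e ` J)" using assms by simp
  fix f x assume f: "(\<Sum>x\<in>e ` J. scale (f x) x) = 0" and "x \<in> e ` J"
  then obtain j where j: "j \<in> J" "x = e j" by blast
  have "(\<Sum>i\<in>J. scale (f (e i)) (e i)) = 0"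
    using f by (simp add: sum.reindex[OF orthonormal_inj_on[OF assms(1)]])
  then show "f x = 0"
    using orthonormal_ip_sum_left[OF assms j(1), of "\<lambda>i. f (e i)"] j by simp
qed

lemma orthonormal_residual:
  assumes "orthonormal_on J e" "finite J" "j \<in> J"
  shows "ip (v - (\<Sum>i\<in>J. scale (ip v (e i)) (e i))) (e j) = 0"
  using orthonormal_ip_sum_left[OF assms] by (simp add: ip_diff_left)

lemma orthonormal_extend:
  assumes e: "orthonormal_on J e" and "m \<notin> J"
    and r: "r \<noteq> 0" "\<And>j. j \<in> J \<Longrightarrow> ip r (e j) = 0"
  shows "orthonormal_on (insert m J) (e(m := (1 / norm r) *\<^sub>R r))"
proof -
  have 1: "ip ((1 / norm r) *\<^sub>R r) ((1 / norm r) *\<^sub>R r) = 1"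
    using r by (simp add: ip_self)
  show ?thesis
    using e r(2) ip_eq_0_commute[OF r(2)] \<open>m \<notin> J\<close> 1
    unfolding orthonormal_on_def by (auto simp: ip_scaleR_left ip_scaleR_right)
qed

lemma eigenvectors_orthogonal:
  assumes "self_adjoint B" "B u = s *\<^sub>R u" "B v = t *\<^sub>R v" "s \<noteq> t"
  shows "ip u v = 0"
proof -
  have "ip (B u) v = ip u (B v)" using assms(1) unfolding self_adjoint_def by blast
  then have "of_real s * ip u v = of_real t * ip u v"
    using assms by (simp add: ip_scaleR_left ip_scaleR_right)
  then show ?thesis using assms by simp
qed

section \<open>Orthonormal eigenvectors\<close>

text \<open>
  Gram-Schmidt carried out inside the eigenspaces. When \<open>e\<^sub>1, \<dots>, e\<^sub>m\<close> have been chosen, fewer of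
  them belong to the eigenvalue \<open>b\<^sub>m\<^sub>+\<^sub>1\<close> than its multiplicity, so they do not span its eigenspace,
  and the component of some eigenvector orthogonal to them can be normalised.
\<close>

lemma orthonormal_eigenvectors_exist:
  assumes lin: "Vector_Spaces.linear scale scale B" and sa: "self_adjoint B"
    and ev: "lists_nonzero_eigenvalues B n b"
  shows "\<exists>e. orthonormal_on {1..n} e \<and> (\<forall>j\<in>{1..n}. B (e j) = b j *\<^sub>R e j)"
proof -
  interpret B: Vector_Spaces.linear scale scale B by (rule lin)
  have "m \<le> n \<Longrightarrow> \<exists>e. orthonormal_on {1..m} e \<and> (\<forall>j\<in>{1..m}. B (e j) = b j *\<^sub>R e j)" for m
  proof (induction m)
    case 0
    then show ?case by (simp add: orthonormal_on_def)
  next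
    case (Suc m)
    then obtain e where e: "orthonormal_on {1..m} e"
        and Be: "\<And>j. j \<in> {1..m} \<Longrightarrow> B (e j) = b j *\<^sub>R e j"
      by auto
    let ?l = "b (Suc m)"
    define E where "E = eigenspace B (of_real ?l)"
    have E: "v \<in> E \<longleftrightarrow> B v = ?l *\<^sub>R v" for v
      by (simp add: E_def eigenspace_def scale_of_real)
    have "?l \<noteq> 0"
      using ev Suc.prems by (auto simp: lists_nonzero_eigenvalues_def)
    then have "card {j \<in> {1..n}. of_real (b j) = (of_real ?l :: 'k)} = dim E"
      using ev unfolding lists_nonzero_eigenvalues_def E_def by (metis of_real_eq_0_iff)
    then have dimE: "dim E = card {j \<in> {1..n}. b j = ?l}"
      by (simp only: of_real_eq_iff)
    define I where "I = {j \<in> {1..m}. b j = ?l}"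
    have "I \<subseteq> {j \<in> {1..n}. b j = ?l}" "Suc m \<in> {j \<in> {1..n}. b j = ?l}" "Suc m \<notin> I"
      using Suc.prems by (auto simp: I_def)
    then have "I \<subset> {j \<in> {1..n}. b j = ?l}" by blast
    then have "card I < dim E"
      unfolding dimE by (intro psubset_card_mono) auto
    moreover have "card (e ` I) \<le> card I"
      by (rule card_image_le) (simp add: I_def)
    ultimately have "\<not> E \<subseteq> span (e ` I)"
      using dim_le_card[of E "e ` I"] by (auto simp: I_def)
    then obtain y where y: "y \<in> E" "y \<notin> span (e ` I)" by blast
    define r where "r = y - (\<Sum>i\<in>{1..m}. scale (ip y (e i)) (e i))"
    \<comment> \<open>Eigenvectors for other eigenvalues are orthogonal to y, so only those indexed by I
      contribute to the projection.\<close>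
    have orth: "ip y (e i) = 0" if "i \<in> {1..m} - I" for i
      using that by (intro eigenvectors_orthogonal[OF sa y(1)[unfolded E] Be]) (auto simp: I_def)
    have r_I: "r = y - (\<Sum>i\<in>I. scale (ip y (e i)) (e i))"
      unfolding r_def
      by (intro arg_cong2[where f = "(-)"] refl sum.mono_neutral_right ballI)
        (auto simp: orth I_def)
    have "r \<noteq> 0"
    proof
      assume "r = 0"
      then have "y = (\<Sum>i\<in>I. scale (ip y (e i)) (e i))" using r_I by simp
      also have "\<dots> \<in> span (e ` I)"
        by (intro span_sum span_scale span_base) auto
      finally show False using y by blast
    qed
    have "B r = B y - (\<Sum>i\<in>I. scale (ip y (e i)) (B (e i)))"
      by (simp add: r_I B.diff B.sum B.scale)
    also have "\<dots> = ?l *\<^sub>R r"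
      unfolding r_I using y(1) Be
      by (auto simp: E I_def scale_of_real[symmetric] mult.commute
          scale_right_diff_distrib scale_sum_right)
    finally have Br: "B r = ?l *\<^sub>R r" .
    define e' where "e' = e(Suc m := (1 / norm r) *\<^sub>R r)"
    have "orthonormal_on (insert (Suc m) {1..m}) e'"
      unfolding e'_def
      using orthonormal_residual[OF e, of _ y] \<open>r \<noteq> 0\<close>
      by (intro orthonormal_extend[OF e]) (auto simp: r_def)
    moreover have "insert (Suc m) {1..m} = {1..Suc m}" by auto
    moreover have "B ((1 / norm r) *\<^sub>R r) = ?l *\<^sub>R ((1 / norm r) *\<^sub>R r)"
      using Br by (simp add: linear_scaleR[OF lin])
    then have "\<forall>j\<in>{1..Suc m}. B (e' j) = b j *\<^sub>R e' j"
      using Be by (auto simp: e'_def)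
    ultimately show ?case by metis
  qed
  then show ?thesis by blast
qed

text \<open>
  The \<open>n\<close> orthonormal eigenvectors lie in the range of \<open>B\<close>, since their eigenvalues are nonzero,
  and the range has dimension \<open>n\<close>. So they span it, and expanding \<open>B v\<close> in them gives the
  coefficients \<open>\<langle>B v, e\<^sub>j\<rangle> = \<langle>v, B e\<^sub>j\<rangle> = b\<^sub>j \<langle>v, e\<^sub>j\<rangle>\<close>.
\<close>

lemma diagonalization:
  assumes pos: "positive_operator B" and rk: "has_finite_rank B n"
    and ev: "lists_nonzero_eigenvalues B n b"
  obtains e where "orthonormal_on {1..n} e"
    "\<And>v. B v = (\<Sum>j=1..n. b j *\<^sub>R rank_one (e j) (e j) v)"
proof -
  have lin: "Vector_Spaces.linear scale scale B" and sa: "self_adjoint B"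
    using pos by (auto simp: positive_operator_def bounded_operator_def)
  interpret B: Vector_Spaces.linear scale scale B by (rule lin)
  obtain e where e: "orthonormal_on {1..n} e"
      and Be: "\<And>j. j \<in> {1..n} \<Longrightarrow> B (e j) = b j *\<^sub>R e j"
    using orthonormal_eigenvectors_exist[OF lin sa ev] by blast
  have bnz: "b j \<noteq> 0" if "j \<in> {1..n}" for j
    using ev that by (auto simp: lists_nonzero_eigenvalues_def)
  have e_range: "e j \<in> range B" if "j \<in> {1..n}" for j
  proof -
    have "B ((1 / b j) *\<^sub>R e j) = e j"
      using bnz[OF that] Be[OF that] by (simp add: linear_scaleR[OF lin])
    then show ?thesis by (metis rangeI)
  qed
  obtain X where X: "X \<subseteq> range B" "independent X" "range B \<subseteq> span X" "card X = n"
    using rk basis_exists[of "range B"] by (metis has_finite_rank_def)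
  obtain S where "finite S" "range B \<subseteq> span S"
    using rk by (auto simp: has_finite_rank_def)
  then have "finite X" using independent_span_bound X by blast
  have expand: "w = (\<Sum>j=1..n. scale (ip w (e j)) (e j))" if "w \<in> range B" for w
  proof (rule ccontr)
    define r where "r = w - (\<Sum>j=1..n. scale (ip w (e j)) (e j))"
    assume "\<not> ?thesis"
    \<comment> \<open>A nonzero residual would be an (n + 1)-st orthonormal vector in the range.\<close>
    then have "r \<noteq> 0" by (simp add: r_def)
    define e' where "e' = e(Suc n := (1 / norm r) *\<^sub>R r)"
    have o: "orthonormal_on (insert (Suc n) {1..n}) e'"
      unfolding e'_def
      using orthonormal_residual[OF e, of _ w] \<open>r \<noteq> 0\<close>
      by (intro orthonormal_extend[OF e]) (auto simp: r_def)
    have sub: "subspace (range B)"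
      using B.subspace_image[OF subspace_UNIV] .
    have "r \<in> range B"
      unfolding r_def using that e_range sub
      by (intro subspace_diff subspace_sum subspace_scale) auto
    then have "scale (of_real (1 / norm r)) r \<in> range B"
      using sub subspace_scale by blast
    then have "e' ` insert (Suc n) {1..n} \<subseteq> range B"
      using e_range by (auto simp: e'_def scale_of_real simp del: of_real_divide)
    then have "e' ` insert (Suc n) {1..n} \<subseteq> span X" using X(3) by blast
    then have "card (e' ` insert (Suc n) {1..n}) \<le> n"
      using independent_span_bound[OF \<open>finite X\<close> orthonormal_independent[OF o]] X(4) by simp
    then show False
      by (simp only: card_image[OF orthonormal_inj_on[OF o]]) simp
  qed
  have "B v = (\<Sum>j=1..n. b j *\<^sub>R rank_one (e j) (e j) v)" for v
  proof -
    have "B v = (\<Sum>j=1..n. scale (ip (B v) (e j)) (e j))"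
      by (rule expand) simp
    also have "\<dots> = (\<Sum>j=1..n. b j *\<^sub>R rank_one (e j) (e j) v)"
    proof (rule sum.cong[OF refl])
      fix j assume j: "j \<in> {1..n}"
      have "ip (B v) (e j) = of_real (b j) * ip v (e j)"
        using sa Be[OF j] by (simp add: self_adjoint_def ip_scaleR_right)
      then show "scale (ip (B v) (e j)) (e j) = b j *\<^sub>R rank_one (e j) (e j) v"
        by (simp add: rank_one_def scale_of_real[symmetric])
    qed
    finally show ?thesis .
  qed
  with e show ?thesis using that by blast
qed

section \<open>The inequalities are necessary\<close>

lemma rank_one_form:
  "ip (\<Sum>i\<in>I. c i *\<^sub>R rank_one (x i) (x i) v) v = of_real (\<Sum>i\<in>I. c i * modsq (ip v (x i)))"
  unfolding ip_sum_left of_real_sum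
  by (intro sum.cong) (simp_all add: rank_one_def ip_scaleR_left ip_scale_left ip_mult_swap)

end

text \<open>
  The left side minus the right side is
  \<open>(\<Sum>j\<le>p. b j * (w j - 1)) + (\<Sum>j>p. b j * w j)\<close>. Replacing every \<open>b j\<close> by \<open>b p\<close> can only
  increase this to \<open>b p * ((\<Sum>j. w j) - p) \<le> 0\<close>, because the factors \<open>w j - 1\<close> are nonpositive and
  belong to the larger \<open>b j\<close>, and the factors \<open>w j\<close> are nonnegative and belong to the smaller ones.
\<close>

lemma weighted_sum_le_top_sum:
  fixes b w :: "nat \<Rightarrow> real"
  assumes anti: "antimono_on {1..n} b" and b: "\<And>j. j \<in> {1..n} \<Longrightarrow> b j \<ge> 0"
    and w: "\<And>j. j \<in> {1..n} \<Longrightarrow> 0 \<le> w j \<and> w j \<le> 1"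
    and sum_w: "(\<Sum>j=1..n. w j) \<le> real p" and p: "1 \<le> p" "p \<le> n"
  shows "(\<Sum>j=1..n. b j * w j) \<le> (\<Sum>j=1..p. b j)"
proof -
  have split: "(\<Sum>j=1..n. f j) = (\<Sum>j=1..p. f j) + (\<Sum>j=Suc p..n. f j)" for f :: "nat \<Rightarrow> real"
    using sum.ub_add_nat[of 1 p f "n - p"] p by simp
  have "(\<Sum>j=1..n. b j * w j) - (\<Sum>j=1..p. b j)
      = (\<Sum>j=1..p. b j * (w j - 1)) + (\<Sum>j=Suc p..n. b j * w j)"
    unfolding split[of "\<lambda>j. b j * w j"] by (simp add: right_diff_distrib sum_subtractf)
  also have "\<dots> \<le> (\<Sum>j=1..p. b p * (w j - 1)) + (\<Sum>j=Suc p..n. b p * w j)"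
  proof (intro add_mono sum_mono)
    fix j assume "j \<in> {1..p}"
    then have "b p \<le> b j" "w j \<le> 1" using monotone_onD[OF anti, of j p] w[of j] p by auto
    then show "b j * (w j - 1) \<le> b p * (w j - 1)"
      by (intro mult_right_mono_neg) auto
  next
    fix j assume "j \<in> {Suc p..n}"
    then have "b j \<le> b p" "0 \<le> w j" using monotone_onD[OF anti, of p j] w[of j] p by auto
    then show "b j * w j \<le> b p * w j" by (rule mult_right_mono)
  qed
  also have "\<dots> = b p * ((\<Sum>j=1..n. w j) - real p)"
    unfolding split[of w] by (simp add: sum_distrib_left[symmetric] sum_subtractf algebra_simps)
  also have "\<dots> \<le> 0"
    using b[of p] p sum_w by (intro mult_nonneg_nonpos) auto
  finally show ?thesis by simp
qed

context hilbert_space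
begin

text \<open>
  Everything is read off from the quadratic form \<open>\<langle>B v, v\<rangle>\<close>, which both decompositions express
  as a weighted sum of squares. It is evaluated at \<open>v = e\<^sub>j\<close> (column sums), at the component of \<open>x\<^sub>i\<close>
  orthogonal to all \<open>e\<^sub>j\<close>, where it vanishes (so that \<open>x\<^sub>i\<close> is in the span of the \<open>e\<^sub>j\<close>), and at
  the solution \<open>y\<close> of \<open>B y = x\<^sub>i\<close> (row sums).
\<close>

lemma decomposition_imp_partial_sums_le:
  assumes e: "orthonormal_on {1..n} e"
    and Be: "\<And>v. B v = (\<Sum>j=1..n. b j *\<^sub>R rank_one (e j) (e j) v)"
    and Bx: "\<And>v. B v = (\<Sum>i=1..k. c i *\<^sub>R rank_one (x i) (x i) v)"
    and x: "\<And>i. i \<in> {1..k} \<Longrightarrow> norm (x i) = 1"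
    and anti: "antimono_on {1..n} b"
    and b: "\<And>j. j \<in> {1..n} \<Longrightarrow> b j > 0"
    and c: "\<And>i. i \<in> {1..k} \<Longrightarrow> c i > 0"
    and p: "1 \<le> p" "p \<le> n" "p \<le> k"
  shows "(\<Sum>i=1..p. c i) \<le> (\<Sum>i=1..p. b i)"
proof -
  define a where "a i j = modsq (ip (x i) (e j))" for i j
  have a0: "0 \<le> a i j" for i j by (simp add: a_def modsq_nonneg)
  have form_e: "ip (B v) v = of_real (\<Sum>j=1..n. b j * modsq (ip v (e j)))" for v
    unfolding Be by (rule rank_one_form)
  have form_x: "ip (B v) v = of_real (\<Sum>i=1..k. c i * modsq (ip v (x i)))" for v
    unfolding Bx by (rule rank_one_form)
  have forms: "(\<Sum>i=1..k. c i * modsq (ip v (x i))) = (\<Sum>j=1..n. b j * modsq (ip v (e j)))" for v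
    using form_e[of v] form_x[of v] by (simp only: of_real_eq_iff)
  have form_ge: "c i * modsq (ip v (x i)) \<le> (\<Sum>j=1..n. b j * modsq (ip v (e j)))"
    if "i \<in> {1..k}" for i v
    unfolding forms[symmetric] using that c modsq_nonneg
    by (intro member_le_sum) (auto intro!: mult_nonneg_nonneg simp: less_imp_le)
  have one: "modsq (1::'k) = 1" using modsq_of_real[of 1, where 'a = 'k] by simp
  have zero: "modsq (0::'k) = 0" by (simp add: modsq_eq_0_iff)
  have col: "(\<Sum>i=1..k. c i * a i j) = b j" if j: "j \<in> {1..n}" for j
  proof -
    have "(\<Sum>i=1..k. c i * a i j) = (\<Sum>l=1..n. b l * modsq (ip (e j) (e l)))"
      unfolding forms[symmetric] a_def by (simp add: modsq_ip_commute)
    also have "\<dots> = (\<Sum>l=1..n. if l = j then b l else 0)"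
      using e j by (intro sum.cong) (auto simp: orthonormal_on_def one zero)
    finally show ?thesis using j by simp
  qed
  have row: "(\<Sum>j=1..n. a i j) = 1" if i: "i \<in> {1..k}" for i
  proof -
    define r where "r = x i - (\<Sum>j=1..n. scale (ip (x i) (e j)) (e j))"
    have "ip r (e j) = 0" if "j \<in> {1..n}" for j
      unfolding r_def by (rule orthonormal_residual[OF e _ that]) simp
    then have "c i * modsq (ip r (x i)) \<le> 0"
      using form_ge[OF i, of r] by (simp add: zero)
    then have "modsq (ip r (x i)) = 0"
      using c[OF i] modsq_nonneg[of "ip r (x i)"] by (simp add: mult_le_0_iff)
    then have "ip r (x i) = 0" by (simp add: modsq_eq_0_iff)
    moreover have "ip r (x i) = of_real (1 - (\<Sum>j=1..n. a i j))"
      unfolding r_def by (simp add: ip_diff_left ip_sum_left ip_scale_left ip_mult_swap a_def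
          ip_self x[OF i])
    ultimately have "1 - (\<Sum>j=1..n. a i j) = 0" by (simp only: of_real_eq_0_iff)
    then show ?thesis by simp
  qed
  have row_weighted: "c i * (\<Sum>j=1..n. a i j / b j) \<le> 1" if i: "i \<in> {1..k}" for i
  proof -
    define s where "s = (\<Sum>j=1..n. a i j / b j)"
    have "s \<ge> 0" unfolding s_def using a0 b by (intro sum_nonneg) (simp add: less_imp_le)
    \<comment> \<open>y solves B y = x i, and s is the value of the quadratic form at y.\<close>
    define y where "y = (\<Sum>j=1..n. scale (of_real (1 / b j) * ip (x i) (e j)) (e j))"
    have ye: "ip y (e j) = of_real (1 / b j) * ip (x i) (e j)" if "j \<in> {1..n}" for j
      unfolding y_def by (rule orthonormal_ip_sum_left[OF e _ that]) simp
    have "b j * modsq (ip y (e j)) = a i j / b j" if j: "j \<in> {1..n}" for j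
      using b[OF j] unfolding ye[OF j] modsq_mult modsq_of_real a_def
      by (simp add: power2_eq_square field_simps)
    then have "(\<Sum>j=1..n. b j * modsq (ip y (e j))) = s" by (simp add: s_def)
    moreover have "ip y (x i) = of_real s"
      unfolding y_def s_def ip_sum_left ip_scale_left of_real_sum
      by (intro sum.cong) (simp_all add: mult.assoc ip_mult_swap a_def)
    ultimately have "c i * s\<^sup>2 \<le> s"
      using form_ge[OF i, of y] by (simp add: modsq_of_real)
    then have "s * (c i * s) \<le> s * 1" by (simp add: power2_eq_square algebra_simps)
    then show ?thesis
      using \<open>s \<ge> 0\<close> unfolding s_def[symmetric] by (cases "s = 0") auto
  qed
  define w where "w j = (\<Sum>i=1..p. c i * a i j) / b j" for j
  have w: "0 \<le> w j \<and> w j \<le> 1" if j: "j \<in> {1..n}" for j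
  proof
    have *: "0 \<le> c i * a i j" if "i \<in> {1..k}" for i
      using c[OF that] a0 by simp
    show "0 \<le> w j"
      unfolding w_def using b[OF j] * p by (intro divide_nonneg_pos sum_nonneg) auto
    have "(\<Sum>i=1..p. c i * a i j) \<le> (\<Sum>i=1..k. c i * a i j)"
      using p * by (intro sum_mono2) auto
    then show "w j \<le> 1"
      unfolding w_def using b[OF j] col[OF j] by simp
  qed
  have "(\<Sum>j=1..n. w j) = (\<Sum>i=1..p. c i * (\<Sum>j=1..n. a i j / b j))"
    unfolding w_def sum_divide_distrib sum_distrib_left by (subst sum.swap) simp
  also have "\<dots> \<le> (\<Sum>i=1..p. 1)"
    using row_weighted p by (intro sum_mono) auto
  finally have sum_w: "(\<Sum>j=1..n. w j) \<le> real p" by simp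
  have "(\<Sum>i=1..p. c i) = (\<Sum>i=1..p. c i * (\<Sum>j=1..n. a i j))"
    using row p by (intro sum.cong) auto
  also have "\<dots> = (\<Sum>j=1..n. \<Sum>i=1..p. c i * a i j)"
    unfolding sum_distrib_left by (rule sum.swap)
  also have "\<dots> = (\<Sum>j=1..n. b j * w j)"
  proof (rule sum.cong[OF refl])
    fix j assume "j \<in> {1..n}"
    from b[OF this] show "(\<Sum>i=1..p. c i * a i j) = b j * w j" by (simp add: w_def)
  qed
  also have "\<dots> \<le> (\<Sum>j=1..p. b j)"
    by (rule weighted_sum_le_top_sum[OF anti less_imp_le[OF b] w sum_w p(1,2)])
  finally show ?thesis .
qed

section \<open>The inequalities are sufficient\<close>

lemma rotation_preserves_rank_one_sum:
  assumes "s\<^sup>2 + t\<^sup>2 = 1"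
  shows "rank_one (s *\<^sub>R y + t *\<^sub>R z) (s *\<^sub>R y + t *\<^sub>R z) v
       + rank_one (s *\<^sub>R z - t *\<^sub>R y) (s *\<^sub>R z - t *\<^sub>R y) v
       = rank_one y y v + rank_one z z v"
proof -
  let ?s = "of_real s :: 'k" and ?t = "of_real t :: 'k"
  have st: "?s * ?s + ?t * ?t = 1"
    using arg_cong[OF assms, of "of_real :: real \<Rightarrow> 'k"] by (simp add: power2_eq_square)
  let ?p = "ip v y" and ?q = "ip v z"
  have "rank_one (s *\<^sub>R y + t *\<^sub>R z) (s *\<^sub>R y + t *\<^sub>R z) v
       + rank_one (s *\<^sub>R z - t *\<^sub>R y) (s *\<^sub>R z - t *\<^sub>R y) v
     = scale ((?s * ?p + ?t * ?q) * ?s - (?s * ?q - ?t * ?p) * ?t) y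
     + scale ((?s * ?p + ?t * ?q) * ?t + (?s * ?q - ?t * ?p) * ?s) z"
    unfolding rank_one_def scale_of_real[symmetric] diff_conv_add_uminus
      ip_add_right ip_minus_right ip_scale_right sconj_of_real
    by (simp add: scale_left_distrib scale_right_distrib algebra_simps)
  also have "(?s * ?p + ?t * ?q) * ?s - (?s * ?q - ?t * ?p) * ?t = (?s * ?s + ?t * ?t) * ?p"
    by (simp add: algebra_simps)
  also have "(?s * ?p + ?t * ?q) * ?t + (?s * ?q - ?t * ?p) * ?s = (?s * ?s + ?t * ?t) * ?q"
    by (simp add: algebra_simps)
  finally show ?thesis by (simp add: st rank_one_def)
qed

lemma rotation_preserves_norm_sum:
  fixes y z :: 'v
  assumes "s\<^sup>2 + t\<^sup>2 = 1"
  shows "(norm (s *\<^sub>R y + t *\<^sub>R z))\<^sup>2 + (norm (s *\<^sub>R z - t *\<^sub>R y))\<^sup>2 = (norm y)\<^sup>2 + (norm z)\<^sup>2"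
proof -
  let ?s = "of_real s :: 'k" and ?t = "of_real t :: 'k"
  have st: "?s * ?s + ?t * ?t = 1"
    using arg_cong[OF assms, of "of_real :: real \<Rightarrow> 'k"] by (simp add: power2_eq_square)
  have "ip (s *\<^sub>R y + t *\<^sub>R z) (s *\<^sub>R y + t *\<^sub>R z) + ip (s *\<^sub>R z - t *\<^sub>R y) (s *\<^sub>R z - t *\<^sub>R y)
     = (?s * ?s + ?t * ?t) * ip y y + (?s * ?s + ?t * ?t) * ip z z"
    unfolding diff_conv_add_uminus
      ip_add_right ip_minus_right ip_scaleR_right ip_add_left ip_minus_left ip_scaleR_left
    by (simp add: algebra_simps)
  then have "(of_real ((norm (s *\<^sub>R y + t *\<^sub>R z))\<^sup>2 + (norm (s *\<^sub>R z - t *\<^sub>R y))\<^sup>2) :: 'k)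
      = of_real ((norm y)\<^sup>2 + (norm z)\<^sup>2)"
    by (simp add: ip_self st)
  then show ?thesis by (simp only: of_real_eq_iff)
qed

text \<open>
  Rotating the pair \<open>(y, z)\<close> by the angle \<open>\<theta>\<close> makes the first vector move continuously from \<open>y\<close> at
  \<open>\<theta> = 0\<close> to \<open>z\<close> at \<open>\<theta> = pi / 2\<close>, so its squared length takes every value in between. The
  scalars of the rotation are real, which makes the argument the same over \<open>\<real>\<close> and \<open>\<complex>\<close>.
\<close>

lemma redistribute_norms:
  assumes "(norm z)\<^sup>2 \<le> r" "r \<le> (norm y)\<^sup>2"
  obtains y' z' where "(norm y')\<^sup>2 = r" "(norm z')\<^sup>2 = (norm y)\<^sup>2 + (norm z)\<^sup>2 - r"
    "\<And>v. rank_one y' y' v + rank_one z' z' v = rank_one y y v + rank_one z z v"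
proof -
  let ?g = "\<lambda>\<theta>. (norm (cos \<theta> *\<^sub>R y + sin \<theta> *\<^sub>R z))\<^sup>2"
  have "\<exists>\<theta>. 0 \<le> \<theta> \<and> \<theta> \<le> pi / 2 \<and> ?g \<theta> = r"
    by (rule IVT2) (use assms in \<open>auto intro!: continuous_intros\<close>)
  then obtain \<theta> where \<theta>: "?g \<theta> = r" by blast
  have cs: "(cos \<theta>)\<^sup>2 + (sin \<theta>)\<^sup>2 = 1" by simp
  show ?thesis
    using rotation_preserves_norm_sum[OF cs, of y z] \<theta>
    by (intro that[OF \<theta>, of "cos \<theta> *\<^sub>R z - sin \<theta> *\<^sub>R y"] rotation_preserves_rank_one_sum[OF cs]) auto
qed

text \<open>
  Muirhead's argument. Write \<open>d i\<close> for the squared length of \<open>y i\<close>, and let \<open>i\<close> be the first index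
  with \<open>d i < c i\<close>. As the partial sum up to \<open>i\<close> of \<open>d\<close> is not below that of \<open>c\<close>, some \<open>j < i\<close> has
  \<open>c j < d j\<close>. Moving the smaller of the excess \<open>d j - c j\<close> and the deficit \<open>c i - d i\<close> from \<open>j\<close> to
  \<open>i\<close> makes one of the two entries correct and leaves all correct entries alone, so induction on
  the number of incorrect entries applies. Since \<open>d i < c i \<le> c j < d j\<close>, the new lengths lie
  between the old ones; this is where the monotonicity of \<open>c\<close> enters.
\<close>

lemma attain_norms:
  fixes c :: "nat \<Rightarrow> real"
  assumes anti: "antimono_on {1..k} c"
    and "\<And>p. p \<le> k \<Longrightarrow> (\<Sum>i=1..p. c i) \<le> (\<Sum>i=1..p. (norm (y i))\<^sup>2)"
    and "(\<Sum>i=1..k. c i) = (\<Sum>i=1..k. (norm (y i))\<^sup>2)"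
  shows "\<exists>z. (\<forall>i\<in>{1..k}. (norm (z i))\<^sup>2 = c i) \<and>
    (\<forall>v. (\<Sum>i=1..k. rank_one (z i) (z i) v) = (\<Sum>i=1..k. rank_one (y i) (y i) v))"
  using assms(2-)
proof (induction "card {i \<in> {1..k}. (norm (y i))\<^sup>2 \<noteq> c i}" arbitrary: y rule: less_induct)
  case less
  define d where "d i = (norm (y i))\<^sup>2" for i
  show ?case
  proof (cases "\<exists>i\<in>{1..k}. d i < c i")
    case False
    \<comment> \<open>No entry is below its target and the totals agree, so every entry is on target.\<close>
    have "\<forall>i\<in>{1..k}. d i - c i = 0"
      using False less.prems(2) sum_nonneg_eq_0_iff[of "{1..k}" "\<lambda>i. d i - c i"]
      by (auto simp: sum_subtractf d_def not_less)
    then show ?thesis by (intro exI[of _ y]) (auto simp: d_def)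
  next
    case True
    define i where "i = (LEAST i. i \<in> {1..k} \<and> d i < c i)"
    have "i \<in> {1..k} \<and> d i < c i"
      unfolding i_def by (rule LeastI_ex) (use True in blast)
    then have i: "i \<in> {1..k}" "d i < c i" by auto
    have below: "c l \<le> d l" if "l \<in> {1..<i}" for l
      using not_less_Least[of l "\<lambda>i. i \<in> {1..k} \<and> d i < c i", folded i_def] that i(1) by auto
    have "\<exists>j\<in>{1..<i}. c j < d j"
    proof (rule ccontr)
      assume "\<not> ?thesis"
      then have "(\<Sum>l\<in>{1..<i}. d l) \<le> (\<Sum>l\<in>{1..<i}. c l)"
        by (intro sum_mono) (auto simp: not_less)
      moreover have "{1..i} = insert i {1..<i}" using i by auto
      ultimately have "(\<Sum>l=1..i. d l) < (\<Sum>l=1..i. c l)" using i by simp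
      then show False using less.prems(1)[of i] i by (simp add: d_def)
    qed
    then obtain j where j: "j \<in> {1..<i}" "c j < d j" by blast
    have jk: "j \<in> {1..k}" "j \<noteq> i" using i j by auto
    have cij: "c i \<le> c j" using monotone_onD[OF anti, of j i] i j by auto
    define \<delta> where "\<delta> = min (d j - c j) (c i - d i)"
    have \<delta>: "0 < \<delta>" "\<delta> \<le> d j - c j" "\<delta> \<le> c i - d i" "\<delta> = d j - c j \<or> \<delta> = c i - d i"
      using i j by (auto simp: \<delta>_def)
    have "(norm (y i))\<^sup>2 \<le> d j - \<delta>" "d j - \<delta> \<le> (norm (y j))\<^sup>2"
      using \<delta> cij by (auto simp: d_def)
    then obtain u w where u: "(norm u)\<^sup>2 = d j - \<delta>" and w: "(norm w)\<^sup>2 = d i + \<delta>"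
      and uw: "\<And>v. rank_one u u v + rank_one w w v = rank_one (y j) (y j) v + rank_one (y i) (y i) v"
      by (rule redistribute_norms) (auto simp: d_def)
    define y' where "y' = y(j := u, i := w)"
    define d' where "d' l = (norm (y' l))\<^sup>2" for l
    have d': "d' l = d l - (if l = j then \<delta> else 0) + (if l = i then \<delta> else 0)" for l
      using u w jk by (auto simp: d'_def y'_def d_def)
    have sum_d': "(\<Sum>l=1..p. d' l) = (\<Sum>l=1..p. d l) - (if j \<le> p then \<delta> else 0)
        + (if i \<le> p then \<delta> else 0)" for p
      unfolding d' sum.distrib sum_subtractf using i j by simp
    have "(\<Sum>l=1..p. c l) \<le> (\<Sum>l=1..p. d' l)" if p: "p \<le> k" for p
    proof (cases "j \<le> p \<and> p < i")
      case True
      \<comment> \<open>Only these partial sums drop. No entry before i is below its target, so the excess at j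
        alone bounds the slack in the partial sum from below.\<close>
      have "\<delta> \<le> d j - c j" by (rule \<delta>)
      also have "\<dots> \<le> (\<Sum>l=1..p. d l - c l)"
        using True j below by (intro member_le_sum) auto
      finally show ?thesis unfolding sum_d' using True by (simp add: sum_subtractf)
    next
      case False
      then show ?thesis
        unfolding sum_d' using less.prems(1)[OF p] \<delta>(1) j by (auto simp: d_def)
    qed
    moreover have "(\<Sum>l=1..k. c l) = (\<Sum>l=1..k. d' l)"
      unfolding sum_d' using less.prems(2) i jk by (simp add: d_def)
    moreover have "{l \<in> {1..k}. d' l \<noteq> c l} \<subset> {l \<in> {1..k}. d l \<noteq> c l}"
    proof -
      have "{l \<in> {1..k}. d' l \<noteq> c l} \<subseteq> {l \<in> {1..k}. d l \<noteq> c l}"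
        using i j by (auto simp: d' split: if_splits)
      moreover have "d' j = c j \<or> d' i = c i"
        using \<delta>(4) jk by (auto simp: d')
      moreover have "d j \<noteq> c j" "d i \<noteq> c i" using i j by auto
      ultimately show ?thesis using i(1) jk(1) by auto
    qed
    then have "card {l \<in> {1..k}. d' l \<noteq> c l} < card {l \<in> {1..k}. d l \<noteq> c l}"
      by (intro psubset_card_mono) auto
    ultimately obtain z where z: "\<forall>i\<in>{1..k}. (norm (z i))\<^sup>2 = c i"
        "\<And>v. (\<Sum>i=1..k. rank_one (z i) (z i) v) = (\<Sum>i=1..k. rank_one (y' i) (y' i) v)"
      using less.hyps[of y'] unfolding d_def d'_def by blast
    have "(\<Sum>l=1..k. rank_one (y' l) (y' l) v) = (\<Sum>l=1..k. rank_one (y l) (y l) v)" for v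
    proof -
      have split: "(\<Sum>l=1..k. f l) = f j + f i + (\<Sum>l\<in>{1..k} - {j} - {i}. f l)" for f :: "nat \<Rightarrow> 'v"
        using i jk sum.remove[of "{1..k}" j f] sum.remove[of "{1..k} - {j}" i f]
        by (simp add: add.assoc)
      have "(\<Sum>l\<in>{1..k} - {j} - {i}. rank_one (y' l) (y' l) v)
          = (\<Sum>l\<in>{1..k} - {j} - {i}. rank_one (y l) (y l) v)"
        by (intro sum.cong) (auto simp: y'_def)
      then show ?thesis
        unfolding split using uw[of v] jk by (simp add: y'_def)
    qed
    then show ?thesis using z by (intro exI[of _ z]) auto
  qed
qed

lemma rank_one_scaleR: "rank_one (r *\<^sub>R u) (r *\<^sub>R u) v = r\<^sup>2 *\<^sub>R rank_one u u v"
  unfolding rank_one_def ip_scaleR_right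
  by (simp add: scale_of_real[symmetric] power2_eq_square ac_simps)

lemma partial_sums_le_imp_decomposition:
  assumes e: "orthonormal_on {1..n} e"
    and Be: "\<And>v. B v = (\<Sum>j=1..n. b j *\<^sub>R rank_one (e j) (e j) v)"
    and b: "\<And>j. j \<in> {1..n} \<Longrightarrow> b j \<ge> 0"
    and "n \<le> k" and anti: "antimono_on {1..k} c"
    and c: "\<And>i. i \<in> {1..k} \<Longrightarrow> c i > 0"
    and total: "(\<Sum>i=1..k. c i) = (\<Sum>j=1..n. b j)"
    and le: "\<And>p. 1 \<le> p \<Longrightarrow> p < n \<Longrightarrow> (\<Sum>i=1..p. c i) \<le> (\<Sum>i=1..p. b i)"
  shows "\<exists>x. (\<forall>i\<in>{1..k}. norm (x i) = 1) \<and>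
    B = (\<lambda>v. \<Sum>i=1..k. c i *\<^sub>R rank_one (x i) (x i) v)"
proof -
  define y where "y j = (if j \<le> n then sqrt (b j) *\<^sub>R e j else 0)" for j
  have norm_e: "norm (e j) = 1" if "j \<in> {1..n}" for j
    by (rule norm_eq_1I) (use e that in \<open>auto simp: orthonormal_on_def\<close>)
  have y: "(norm (y j))\<^sup>2 = (if j \<le> n then b j else 0)" if "1 \<le> j" for j
    using that b[of j] norm_e[of j] by (simp add: y_def power_mult_distrib)
  have tail: "(\<Sum>j=1..p. f j) = (\<Sum>j=1..n. f j)" if "\<And>j. n < j \<Longrightarrow> f j = 0" "n \<le> p"
    for p and f :: "nat \<Rightarrow> 'z::comm_monoid_add"
    using that by (intro sum.mono_neutral_right) auto
  have sum_small: "(\<Sum>i=1..p. (norm (y i))\<^sup>2) = (\<Sum>i=1..p. b i)" if "p \<le> n" for p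
    using that by (intro sum.cong) (auto simp: y)
  have sum_large: "(\<Sum>i=1..p. (norm (y i))\<^sup>2) = (\<Sum>i=1..n. b i)" if "n \<le> p" for p
    using tail[of "\<lambda>i. (norm (y i))\<^sup>2" p] that sum_small[of n] by (simp add: y_def)
  have "(\<Sum>i=1..p. c i) \<le> (\<Sum>i=1..p. (norm (y i))\<^sup>2)" if "p \<le> k" for p
  proof (cases "p < n")
    case True
    then show ?thesis using le[of p] sum_small[of p] by (cases "p = 0") auto
  next
    case False
    have "(\<Sum>i=1..p. c i) \<le> (\<Sum>i=1..k. c i)"
      using that c by (intro sum_mono2) (auto intro: less_imp_le)
    then show ?thesis using False sum_large[of p] total by simp
  qed
  from attain_norms[OF anti this]
  obtain z where z: "\<And>i. i \<in> {1..k} \<Longrightarrow> (norm (z i))\<^sup>2 = c i"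
      and sum_z: "\<And>v. (\<Sum>i=1..k. rank_one (z i) (z i) v) = (\<Sum>i=1..k. rank_one (y i) (y i) v)"
    unfolding sum_large[OF \<open>n \<le> k\<close>] total by blast
  define x where "x i = (1 / sqrt (c i)) *\<^sub>R z i" for i
  have norm_z: "norm (z i) = sqrt (c i)" if "i \<in> {1..k}" for i
    using z[OF that] by (metis norm_ge_zero real_sqrt_unique)
  have "norm (x i) = 1" if "i \<in> {1..k}" for i
    using c[OF that] norm_z[OF that] by (simp add: x_def)
  moreover have "B v = (\<Sum>i=1..k. c i *\<^sub>R rank_one (x i) (x i) v)" for v
  proof -
    have "B v = (\<Sum>j=1..n. rank_one (y j) (y j) v)"
      unfolding Be using b by (intro sum.cong) (auto simp: y_def rank_one_scaleR)
    also have "\<dots> = (\<Sum>j=1..k. rank_one (y j) (y j) v)"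
      using \<open>n \<le> k\<close> by (intro tail[symmetric]) (auto simp: y_def rank_one_def)
    also have "\<dots> = (\<Sum>i=1..k. c i *\<^sub>R rank_one (x i) (x i) v)"
      unfolding sum_z[symmetric] x_def rank_one_scaleR
    proof (rule sum.cong[OF refl])
      fix i assume "i \<in> {1..k}"
      from c[OF this] show "rank_one (z i) (z i) v
          = c i *\<^sub>R (1 / sqrt (c i))\<^sup>2 *\<^sub>R rank_one (z i) (z i) v"
        by (simp add: power_divide)
    qed
    finally show ?thesis .
  qed
  ultimately show ?thesis by blast
qed

end

section \<open>The characterization\<close>

theorem theorem2:
  fixes scale :: "'k::real_or_complex \<Rightarrow> 'v::banach \<Rightarrow> 'v"
    and ip :: "'v \<Rightarrow> 'v \<Rightarrow> 'k"
    and B :: "'v \<Rightarrow> 'v"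
    and n k :: nat
    and b c :: "nat \<Rightarrow> real"
  assumes "separable_hilbert_space scale ip"
    and "hilbert_space.positive_operator scale ip B"
    and "hilbert_space.has_finite_rank scale B n"
    and "hilbert_space.lists_nonzero_eigenvalues scale B n b"
    and "antimono_on {1..n} b"
    and "\<And>j. j \<in> {1..n} \<Longrightarrow> b j > 0"
    and "k \<ge> n"
    and "antimono_on {1..k} c"
    and "\<And>i. i \<in> {1..k} \<Longrightarrow> c i > 0"
    and "(\<Sum>i=1..k. c i) = (\<Sum>j=1..n. b j)"
  shows "(\<exists>x :: nat \<Rightarrow> 'v. (\<forall>i\<in>{1..k}. norm (x i) = 1) \<and>
            B = (\<lambda>v. \<Sum>i=1..k. c i *\<^sub>R hilbert_space.rank_one scale ip (x i) (x i) v))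
       \<longleftrightarrow> (\<forall>p. 1 \<le> p \<and> p \<le> n - 1 \<longrightarrow> (\<Sum>i=1..p. c i) \<le> (\<Sum>i=1..p. b i))"
    (is "?L \<longleftrightarrow> ?R")
proof -
  interpret separable_hilbert_space scale ip by (rule assms(1))
  obtain e where e: "orthonormal_on {1..n} e"
      and Be: "\<And>v. B v = (\<Sum>j=1..n. b j *\<^sub>R rank_one (e j) (e j) v)"
    using diagonalization[OF assms(2-4)] by metis
  show ?thesis
  proof
    assume ?L
    then obtain x where x: "\<And>i. i \<in> {1..k} \<Longrightarrow> norm (x i) = 1"
        and Bx: "B = (\<lambda>v. \<Sum>i=1..k. c i *\<^sub>R rank_one (x i) (x i) v)"
      by blast
    show ?R
    proof (intro allI impI)
      fix p assume "1 \<le> p \<and> p \<le> n - 1"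
      then show "(\<Sum>i=1..p. c i) \<le> (\<Sum>i=1..p. b i)"
        using \<open>k \<ge> n\<close>
        by (intro decomposition_imp_partial_sums_le[OF e Be fun_cong[OF Bx] x assms(5,6,9)]) auto
    qed
  next
    assume ?R
    then have le: "(\<Sum>i=1..p. c i) \<le> (\<Sum>i=1..p. b i)" if "1 \<le> p" "p < n" for p
      using that by simp
    show ?L
      by (rule partial_sums_le_imp_decomposition[OF e Be less_imp_le[OF assms(6)] assms(7-10) le])
  qed
qed

end
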